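(* Let $k, r\in\mathbb{N}$ be fixed, let $m=m(n)$ be a nonnegative integer (possibly depending on $n$) and let $L\geq 4e^3$. Let $X$ be an $n$-element set, let $H^{(k)}(n,m)$ denote the random $k$-uniform hypergraph on vertex set $X$ whose edge set is a uniformly random set of $m$ elements of $\binom{X}{k}$, and define $g\colon 2^X\to[0,1]$ by $g:=\frac{1}{r}\cdot\mathds{1}_{H^{(k)}(n,m)}$, i.e.\ $g(S)=1/r$ if $S$ is an edge of $H^{(k)}(n,m)$ and $g(S)=0$ otherwise. Then asymptotically almost surely (i.e.\ with probability tending to $1$ as $n\to\infty$) the following holds: if $p\in[0,1]$ is such that $w(g,p)=1$, then there exists $G\subseteq 2^X\setminus\{\emptyset\}$ such that $\langle g\rangle\subseteq\langle G\rangle$ and $w\left(G,\frac{p}{L}\right)\leq 1$.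
   Context: For a finite set $X$, $p\in[0,1]$, $G\subseteq 2^X$ and $g\colon 2^X\to[0,1]$ define $w(G,p):=\sum_{S\in G}p^{|S|}$, $\langle G\rangle:=\{S\subseteq X:\exists T\in G,\ T\subseteq S\}$, $w(g,p):=\sum_{S\in 2^X} g(S)p^{|S|}$, and $\langle g\rangle:=\{S\subseteq X: \sum_{T\subseteq S} g(T)\geq 1\}$. *)

theory Defs
  imports "HOL-Probability.Probability"
begin

definition weight :: "'a set set \<Rightarrow> real \<Rightarrow> real" where
  "weight G p = (\<Sum>S\<in>G. p ^ card S)"

definition upset :: "'a set \<Rightarrow> 'a set set \<Rightarrow> 'a set set" where
  "upset X G = {S. S \<subseteq> X \<and> (\<exists>T\<in>G. T \<subseteq> S)}"

text \<open>
  The fractional versions, for a weighting \<open>g\<close> of the subsets of \<open>X\<close>;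
  values of \<open>g\<close> outside \<open>Pow X\<close> are never used.
\<close>

definition frac_weight :: "'a set \<Rightarrow> ('a set \<Rightarrow> real) \<Rightarrow> real \<Rightarrow> real" where
  "frac_weight X g p = (\<Sum>S\<in>Pow X. g S * p ^ card S)"

definition frac_upset :: "'a set \<Rightarrow> ('a set \<Rightarrow> real) \<Rightarrow> 'a set set" where
  "frac_upset X g = {S. S \<subseteq> X \<and> (\<Sum>T\<in>Pow S. g T) \<ge> 1}"

text \<open>
  A hypergraph is identified with its edge set. For finite \<open>X\<close> the set sampled from is
  nonempty, so that \<^const>\<open>pmf_of_set\<close> is meaningful, exactly when
  \<open>m \<le> card X choose k\<close>.
\<close>

definition random_hypergraph :: "nat \<Rightarrow> 'a set \<Rightarrow> nat \<Rightarrow> 'a set set pmf" where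
  "random_hypergraph k X m =
     pmf_of_set {H. H \<subseteq> {e. e \<subseteq> X \<and> card e = k} \<and> card H = m}"

definition scaled_indicator :: "nat \<Rightarrow> 'a set set \<Rightarrow> 'a set \<Rightarrow> real" where
  "scaled_indicator r H S = (1 / real r) * indicator H S"

end

theory Submission
  imports Defs
begin

text \<open>
  The cover consists of all unions of \<open>r\<close> edges of the hypergraph. The condition \<open>w(g, p) = 1\<close> reads
  \<open>m p\<^sup>k = r\<close>, so \<open>p\<close> does not depend on the sample, and it suffices that for each fixed size
  \<open>s \<le> k r\<close> the unions of size \<open>s\<close> have weight at most \<open>2\<^sup>-\<^sup>s\<close> with high probability. For \<open>s = k r\<close> this
  holds deterministically, because there are at most \<open>m choose r\<close> unions. For \<open>s < k r\<close> put
  \<open>t = n p / s\<close>. If \<open>t \<le> e\<^sup>2\<close>, already all \<open>s\<close>-sets together are light enough. If \<open>t > e\<^sup>2\<close>, count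
  the \<open>r\<close>-sets of edges with union of size \<open>s\<close>: their expected weight is at most
  \<open>(e t / L)\<^sup>s (e / t\<^sup>k)\<^sup>r \<le> 4\<^sup>-\<^sup>s\<close>. In the sparse case \<open>t \<ge> T\<close> this bound is itself \<open>O(1/T)\<close> and
  Markov's inequality suffices. In the dense case \<open>t < T\<close> the count concentrates by Chebyshev's
  inequality: edge-disjoint \<open>r\<close>-sets are negatively correlated, so the variance is at most the
  number of intersecting pairs, which is \<open>O(n\<^sup>2\<^sup>s\<^sup>-\<^sup>1)\<close>. Letting \<open>T\<close> be a small power of \<open>n\<close> makes both
  error terms vanish.
\<close>

subsection \<open>Binomial estimates and uniform random subsets\<close>

text \<open>One term of the exponential series is at most its sum. This is the estimate s! >=
  (s/e)^s, which turns factorials into powers of e below.\<close>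

lemma power_over_fact_le_exp: "real s ^ s / fact s \<le> exp (real s)"
proof -
  have "(\<Sum>i\<in>{s}. real s ^ i /\<^sub>R fact i) \<le> (\<Sum>i. real s ^ i /\<^sub>R fact i)"
    by (intro sum_le_suminf summable_exp_generic) auto
  then show ?thesis
    by (simp add: exp_def field_simps)
qed

lemma binomial_le_exp_power: "real (n choose s) \<le> (exp 1 * real n / real s) ^ s"
proof (cases "s = 0")
  case False
  have "real (n choose s) * fact s \<le> real n ^ s"
    using binomial_fact_pow[of n s] by (metis of_nat_fact of_nat_le_iff of_nat_mult of_nat_power)
  then have "real (n choose s) \<le> real n ^ s / fact s"
    by (simp add: field_simps)
  also have "\<dots> = (real n / real s) ^ s * (real s ^ s / fact s)"
    using False by (simp add: power_divide)
  also have "\<dots> \<le> (real n / real s) ^ s * exp (real s)"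
    by (intro mult_left_mono power_over_fact_le_exp) auto
  also have "\<dots> = (exp 1 * real n / real s) ^ s"
    using exp_of_nat_mult[of s "1::real"] by (simp add: power_mult_distrib power_divide)
  finally show ?thesis .
qed auto

text \<open>For \<open>a \<le> N\<close> and \<open>m \<le> N\<close> this is the probability that a
  uniformly random \<open>m\<close>-subset of an \<open>N\<close>-set contains a fixed
  \<open>a\<close>-subset. Written in this form it gains a single factor when \<open>a\<close> grows
  by one.\<close>

definition binomial_ratio :: "nat \<Rightarrow> nat \<Rightarrow> nat \<Rightarrow> real" where
  "binomial_ratio m N a = real (m choose a) / real (N choose a)"

lemma binomial_ratio_nonneg: "binomial_ratio m N a \<ge> 0"
  by (simp add: binomial_ratio_def)

text \<open>Raising the lower index multiplies a binomial coefficient by (q - a)/(a + 1), and the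
  denominators cancel in the quotient. For \<open>a \<ge> N\<close> both sides are 0, by truncated
  subtraction and division by zero.\<close>

lemma binomial_ratio_Suc:
  "binomial_ratio m N (Suc a) = binomial_ratio m N a * (real (m - a) / real (N - a))"
proof -
  have "real (Suc a) * real (q choose Suc a) = real (q - a) * real (q choose a)" for q
    using binomial_absorb_comp[of q a] Suc_times_binomial_eq[of q a] binomial_absorption[of a q]
    by (metis of_nat_mult)
  then have "real (q choose Suc a) = real (q - a) * real (q choose a) / real (Suc a)" for q
    by (metis nonzero_mult_div_cancel_left of_nat_0 of_nat_eq_iff nat.distinct(1))
  then show ?thesis
    unfolding binomial_ratio_def by (simp add: mult.commute)
qed

text \<open>The negative correlation of disjoint families of edges.\<close>

lemma binomial_ratio_add_le:
  assumes "m \<le> N"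
  shows "binomial_ratio m N (a + b) \<le> binomial_ratio m N a * binomial_ratio m N b"
proof (induction b)
  case 0
  then show ?case by (simp add: binomial_ratio_def)
next
  case (Suc b)
  \<comment> \<open>For \<open>m \<le> N\<close> the quotient (m - x)/(N - x) decreases in x; if
    \<open>m \<le> a + b\<close>, truncation makes the left side 0.\<close>
  have le: "real (m - (a + b)) / real (N - (a + b)) \<le> real (m - b) / real (N - b)"
  proof (cases "m \<le> a + b")
    case False
    with assms have "real a * real m \<le> real a * real N" by (intro mult_left_mono) auto
    with False assms show ?thesis
      by (simp add: of_nat_diff field_simps)
  qed auto
  have "binomial_ratio m N (a + Suc b)
      = binomial_ratio m N (a + b) * (real (m - (a + b)) / real (N - (a + b)))"
    by (simp add: binomial_ratio_Suc)
  also have "\<dots> \<le> (binomial_ratio m N a * binomial_ratio m N b) * (real (m - b) / real (N - b))"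
    using Suc le by (intro mult_mono) (auto intro: mult_nonneg_nonneg binomial_ratio_nonneg)
  also have "\<dots> = binomial_ratio m N a * binomial_ratio m N (Suc b)"
    by (simp add: binomial_ratio_Suc)
  finally show ?case .
qed

lemma binomial_ratio_le_power:
  assumes "m \<le> N"
  shows "binomial_ratio m N a \<le> (real m / real N) ^ a"
proof (induction a)
  case 0
  then show ?case by (simp add: binomial_ratio_def)
next
  case (Suc a)
  have "binomial_ratio m N (Suc a) \<le> binomial_ratio m N 1 * binomial_ratio m N a"
    using binomial_ratio_add_le[OF assms, of 1 a] by simp
  also have "\<dots> \<le> (real m / real N) * (real m / real N) ^ a"
    using Suc by (intro mult_mono) (auto simp: binomial_ratio_def)
  finally show ?case by simp
qed

text \<open>Removing \<open>A\<close> leaves a free choice of \<open>m - card A\<close> elements of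
  \<open>E - A\<close>; the rest is the identity for choosing a subset of a subset. The product form
  avoids division of natural numbers.\<close>

lemma card_supersets_of_size:
  assumes "finite E" "A \<subseteq> E"
  shows "card {H. H \<subseteq> E \<and> card H = m \<and> A \<subseteq> H} * (card E choose card A)
    = (card E choose m) * (m choose card A)"
proof (cases "card A \<le> m")
  case le: True
  have fin: "finite A" using assms finite_subset by blast
  have "bij_betw (\<lambda>B. A \<union> B) {B. B \<subseteq> E - A \<and> card B = m - card A}
      {H. H \<subseteq> E \<and> card H = m \<and> A \<subseteq> H}"
  proof (rule bij_betw_byWitness[where f' = "\<lambda>H. H - A"])
    show "(\<lambda>B. A \<union> B) ` {B. B \<subseteq> E - A \<and> card B = m - card A}
        \<subseteq> {H. H \<subseteq> E \<and> card H = m \<and> A \<subseteq> H}"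
    proof clarify
      fix B assume B: "B \<subseteq> E - A" "card B = m - card A"
      then have "card (A \<union> B) = card A + card B"
        using assms fin by (intro card_Un_disjoint) (auto intro: finite_subset)
      with B assms le show "A \<union> B \<subseteq> E \<and> card (A \<union> B) = m \<and> A \<subseteq> A \<union> B" by auto
    qed
    show "(\<lambda>H. H - A) ` {H. H \<subseteq> E \<and> card H = m \<and> A \<subseteq> H}
        \<subseteq> {B. B \<subseteq> E - A \<and> card B = m - card A}"
      using fin by (auto simp: card_Diff_subset)
  qed auto
  then have "card {H. H \<subseteq> E \<and> card H = m \<and> A \<subseteq> H} = (card E - card A) choose (m - card A)"
    using n_subsets[of "E - A" "m - card A"] assms fin
    by (simp add: bij_betw_same_card[symmetric] card_Diff_subset)
  moreover have "(card E choose m) * (m choose card A)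
      = (card E choose card A) * ((card E - card A) choose (m - card A))"
  proof (cases "m \<le> card E")
    case True
    with le show ?thesis by (simp add: choose_mult)
  next
    case False
    then have "card E - card A < m - card A"
      using le card_mono[OF assms] by linarith
    with False show ?thesis by (simp add: binomial_eq_0)
  qed
  ultimately show ?thesis by simp
next
  case False
  have "{H. H \<subseteq> E \<and> card H = m \<and> A \<subseteq> H} = {}"
    using False assms(1) by (auto dest: card_mono[rotated] intro: finite_subset)
  then have "card {H. H \<subseteq> E \<and> card H = m \<and> A \<subseteq> H} = 0"
    by (simp only: card.empty)
  with False show ?thesis by (simp add: binomial_eq_0)
qed

lemma finite_subsets_of_size: "finite E \<Longrightarrow> finite {H. H \<subseteq> E \<and> card H = m}"
  by (rule finite_subset[of _ "Pow E"]) auto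

lemma subsets_of_size_nonempty: "finite E \<Longrightarrow> m \<le> card E \<Longrightarrow> {H. H \<subseteq> E \<and> card H = m} \<noteq> {}"
  using obtain_subset_with_card_n by (metis (mono_tags, lifting) empty_Collect_eq)

lemma prob_contains:
  assumes "finite E" "m \<le> card E" "A \<subseteq> E"
  shows "measure_pmf.prob (pmf_of_set {H. H \<subseteq> E \<and> card H = m}) {H. A \<subseteq> H}
    = binomial_ratio m (card E) (card A)"
proof -
  have "{H. H \<subseteq> E \<and> card H = m} \<inter> {H. A \<subseteq> H} = {H. H \<subseteq> E \<and> card H = m \<and> A \<subseteq> H}"
    by auto
  then have "measure_pmf.prob (pmf_of_set {H. H \<subseteq> E \<and> card H = m}) {H. A \<subseteq> H}
      = real (card {H. H \<subseteq> E \<and> card H = m \<and> A \<subseteq> H}) / real (card E choose m)"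
    using n_subsets[OF assms(1), of m]
      measure_pmf_of_set[OF subsets_of_size_nonempty[OF assms(1,2)]
        finite_subsets_of_size[OF assms(1)], of "{H. A \<subseteq> H}"]
    by (simp only:)
  moreover have "card E choose card A \<noteq> 0" "card E choose m \<noteq> 0"
    using assms by (auto simp: card_mono not_less)
  moreover have "real (card {H. H \<subseteq> E \<and> card H = m \<and> A \<subseteq> H}) * real (card E choose card A)
      = real (card E choose m) * real (m choose card A)"
    using card_supersets_of_size[OF assms(1,3), of m] by (metis of_nat_mult)
  ultimately show ?thesis
    by (simp add: binomial_ratio_def frac_eq_eq mult.commute)
qed

section \<open>First and second moments of the number of members of a family contained in the
  sample\<close>

context
  fixes E :: "'a set" and m r :: nat and F :: "'a set set" and M :: "'a set pmf"
  assumes fin: "finite E" and m_le: "m \<le> card E"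
    and F: "\<And>A. A \<in> F \<Longrightarrow> A \<subseteq> E \<and> card A = r"
  defines "M \<equiv> pmf_of_set {H. H \<subseteq> E \<and> card H = m}"
begin

lemma finite_family: "finite F"
  using F fin by (intro finite_subset[of F "Pow E"]) auto

lemma integrable_random_subset: "integrable (measure_pmf M) (f :: 'a set \<Rightarrow> real)"
  unfolding M_def using fin m_le
  by (intro integrable_measure_pmf_finite)
    (simp add: set_pmf_of_set[OF subsets_of_size_nonempty finite_subsets_of_size]
      finite_subsets_of_size)

lemma card_contained_eq_sum:
  "real (card {A \<in> F. A \<subseteq> H}) = (\<Sum>A\<in>F. indicator {H. A \<subseteq> H} H)"
proof -
  have "{A \<in> F. A \<subseteq> H} = F \<inter> {A. A \<subseteq> H}" by auto
  then show ?thesis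
    using finite_family by (simp add: indicator_def sum_of_bool_eq)
qed

lemma expectation_contained:
  "measure_pmf.expectation M (\<lambda>H. real (card {A \<in> F. A \<subseteq> H}))
    = real (card F) * binomial_ratio m (card E) r"
proof -
  have "measure_pmf.expectation M (\<lambda>H. real (card {A \<in> F. A \<subseteq> H}))
      = (\<Sum>A\<in>F. measure_pmf.prob M {H. A \<subseteq> H})"
    by (simp add: card_contained_eq_sum Bochner_Integration.integral_sum integrable_random_subset)
  also have "\<dots> = (\<Sum>A\<in>F. binomial_ratio m (card E) r)"
    using F fin m_le by (intro sum.cong) (auto simp: M_def prob_contains)
  finally show ?thesis by simp
qed

text \<open>The second moment is the sum, over ordered pairs, of the probability that
  \<open>A \<union> B\<close> is contained in the sample. A disjoint pair contributes at most the
  square of the single probability, by negative correlation; an intersecting pair is charged at most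
  1 more. Subtracting the squared mean leaves the number of intersecting pairs.\<close>

lemma variance_contained:
  "measure_pmf.variance M (\<lambda>H. real (card {A \<in> F. A \<subseteq> H}))
    \<le> real (card {(A, B) \<in> F \<times> F. A \<inter> B \<noteq> {}})"
proof -
  define q where "q = binomial_ratio m (card E)"
  define D where "D = {(A, B) \<in> F \<times> F. A \<inter> B \<noteq> {}}"
  have D: "D \<subseteq> F \<times> F" by (auto simp: D_def)
  have prob_le: "measure_pmf.prob M {H. A \<union> B \<subseteq> H} \<le> q r * q r + indicator D (A, B)"
    if "A \<in> F" "B \<in> F" for A B
  proof (cases "(A, B) \<in> D")
    case True
    then show ?thesis by (simp add: add_increasing q_def binomial_ratio_nonneg)
  next
    case False
    then have "card (A \<union> B) = r + r"
      using that F finite_subset[OF _ fin] by (subst card_Un_disjoint) (auto simp: D_def)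
    then have "measure_pmf.prob M {H. A \<union> B \<subseteq> H} = q (r + r)"
      using that F fin m_le prob_contains[of E m "A \<union> B"] by (simp add: M_def q_def)
    then show ?thesis
      using binomial_ratio_add_le[OF m_le, of r r] False by (simp add: q_def)
  qed
  have "measure_pmf.expectation M (\<lambda>H. (real (card {A \<in> F. A \<subseteq> H}))\<^sup>2)
      = measure_pmf.expectation M (\<lambda>H. \<Sum>x\<in>F \<times> F. indicator {H. fst x \<union> snd x \<subseteq> H} H)"
    by (intro Bochner_Integration.integral_cong)
      (auto simp: card_contained_eq_sum power2_eq_square sum_product sum.cartesian_product
        indicator_def intro!: sum.cong)
  also have "\<dots> = (\<Sum>x\<in>F \<times> F. measure_pmf.prob M {H. fst x \<union> snd x \<subseteq> H})"
    by (subst Bochner_Integration.integral_sum) (auto simp: integrable_random_subset)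
  also have "\<dots> \<le> (\<Sum>x\<in>F \<times> F. q r * q r + indicator D x)"
    using prob_le by (intro sum_mono) auto
  also have "\<dots> = (real (card F) * q r)\<^sup>2 + real (card D)"
    using D finite_family
    by (simp add: sum.distrib card_cartesian_product power2_eq_square Int_absorb1
        indicator_def sum_of_bool_eq)
  finally show ?thesis
    by (subst measure_pmf.variance_eq)
      (auto simp: integrable_random_subset expectation_contained q_def D_def)
qed

lemma prob_contained_Markov:
  assumes "a > 0"
  shows "measure_pmf.prob M {H. a \<le> real (card {A \<in> F. A \<subseteq> H})}
    \<le> real (card F) * binomial_ratio m (card E) r / a"
  using integral_Markov_inequality_measure[of "measure_pmf M"
      "\<lambda>H. real (card {A \<in> F. A \<subseteq> H})" "{}" a] assms
  by (simp add: integrable_random_subset expectation_contained)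

lemma prob_contained_Chebyshev:
  assumes "a > 0"
  shows "measure_pmf.prob M {H. real (card F) * binomial_ratio m (card E) r + a
        \<le> real (card {A \<in> F. A \<subseteq> H})}
    \<le> real (card {(A, B) \<in> F \<times> F. A \<inter> B \<noteq> {}}) / a\<^sup>2"
proof -
  let ?Z = "\<lambda>H. real (card {A \<in> F. A \<subseteq> H})"
  have "measure_pmf.prob M {H. real (card F) * binomial_ratio m (card E) r + a \<le> ?Z H}
      \<le> measure_pmf.prob M {H. a \<le> \<bar>?Z H - measure_pmf.expectation M ?Z\<bar>}"
    by (intro measure_pmf.finite_measure_mono) (auto simp: expectation_contained)
  also have "\<dots> \<le> measure_pmf.variance M ?Z / a\<^sup>2"
    using measure_pmf.Chebyshev_inequality[of ?Z _ a] assms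
    by (simp add: integrable_random_subset)
  also have "\<dots> \<le> real (card {(A, B) \<in> F \<times> F. A \<inter> B \<noteq> {}}) / a\<^sup>2"
    by (intro divide_right_mono variance_contained) auto
  finally show ?thesis .
qed

end

subsection \<open>Unions of edges\<close>

text \<open>These families are taken among all possible edges and do not depend on the sample, so
  the moment bounds apply to them.\<close>

definition edge_families :: "nat \<Rightarrow> nat \<Rightarrow> nat \<Rightarrow> 'a set \<Rightarrow> 'a set set set" where
  "edge_families k r s X = {A. A \<subseteq> {e. e \<subseteq> X \<and> card e = k} \<and> card A = r \<and> card (\<Union>A) = s}"

text \<open>One layer of the cover. A vertex set counts once here, however many
  \<open>r\<close>-sets of edges have it as their union.\<close>

definition edge_unions :: "nat \<Rightarrow> nat \<Rightarrow> 'a set set \<Rightarrow> 'a set set" where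
  "edge_unions r s H = {\<Union>A | A. A \<subseteq> H \<and> card A = r \<and> card (\<Union>A) = s}"

lemma finite_edge_families: "finite X \<Longrightarrow> finite (edge_families k r s X)"
  by (rule finite_subset[of _ "Pow (Pow X)"]) (auto simp: edge_families_def)

text \<open>Choose the union \<open>S\<close> first, then any \<open>r\<close> of the
  \<open>k\<close>-subsets of \<open>S\<close>, ignoring that they have to cover
  \<open>S\<close>.\<close>

lemma card_edge_families_le:
  assumes "finite X"
  shows "card (edge_families k r s X) \<le> (card X choose s) * ((s choose k) choose r)"
proof -
  let ?I = "{S. S \<subseteq> X \<and> card S = s}"
  let ?J = "\<lambda>S. {A. A \<subseteq> {e. e \<subseteq> S \<and> card e = k} \<and> card A = r}"
  have card_J: "card (?J S) = (s choose k) choose r" and fin_J: "finite (?J S)" if "S \<in> ?I" for S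
  proof -
    have "finite S" using that assms finite_subset by auto
    then show "card (?J S) = (s choose k) choose r" "finite (?J S)"
      using that by (simp_all add: n_subsets finite_subsets_of_size)
  qed
  have fin_UN: "finite (\<Union>S\<in>?I. ?J S)"
    by (rule finite_UN_I[OF finite_subsets_of_size[OF assms] fin_J])
  have "edge_families k r s X \<subseteq> (\<Union>S\<in>?I. ?J S)"
  proof
    fix A assume "A \<in> edge_families k r s X"
    then have "A \<in> ?J (\<Union>A)" "\<Union>A \<in> ?I"
      by (auto simp: edge_families_def)
    then show "A \<in> (\<Union>S\<in>?I. ?J S)" by blast
  qed
  then have "card (edge_families k r s X) \<le> card (\<Union>S\<in>?I. ?J S)"
    by (rule card_mono[OF fin_UN])
  also have "\<dots> \<le> (\<Sum>S\<in>?I. card (?J S))"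
    by (intro card_UN_le finite_subsets_of_size assms)
  also have "\<dots> = (\<Sum>S\<in>?I. (s choose k) choose r)"
    by (rule sum.cong[OF refl card_J])
  also have "\<dots> = (card X choose s) * ((s choose k) choose r)"
    by (simp add: n_subsets[OF assms])
  finally show ?thesis .
qed

text \<open>Besides \<open>v\<close> the union has \<open>s - 1\<close> free vertices, and on a
  fixed union there are at most 2^(2^s) set systems.\<close>

lemma card_edge_families_at_vertex_le:
  assumes "finite X" "s \<ge> 1"
  shows "card {A \<in> edge_families k r s X. v \<in> \<Union>A} \<le> card X ^ (s - 1) * 2 ^ 2 ^ s"
proof -
  \<comment> \<open>The intersection discards \<open>insert v S\<close> when
    \<open>v \<in> S\<close> or \<open>v\<close> lies outside \<open>X\<close>, so every remaining
    set has exactly \<open>s\<close> elements.\<close>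
  let ?I = "insert v ` {S. S \<subseteq> X \<and> card S = s - 1} \<inter> {S. S \<subseteq> X \<and> card S = s}"
  have fin: "finite {S. S \<subseteq> X \<and> card S = s - 1}"
    by (rule finite_subsets_of_size[OF assms(1)])
  have "{A \<in> edge_families k r s X. v \<in> \<Union>A} \<subseteq> (\<Union>S\<in>?I. Pow (Pow S))"
  proof
    fix A assume "A \<in> {A \<in> edge_families k r s X. v \<in> \<Union>A}"
    then have A: "\<Union>A \<subseteq> X" "card (\<Union>A) = s" "v \<in> \<Union>A"
      by (auto simp: edge_families_def)
    then have "finite (\<Union>A)" using assms(1) finite_subset by blast
    then have "\<Union>A = insert v (\<Union>A - {v})" "card (\<Union>A - {v}) = s - 1"
      using A by auto
    then have "\<Union>A \<in> ?I" using A by blast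
    then show "A \<in> (\<Union>S\<in>?I. Pow (Pow S))" by blast
  qed
  then have "card {A \<in> edge_families k r s X. v \<in> \<Union>A} \<le> card (\<Union>S\<in>?I. Pow (Pow S))"
    using fin finite_subset[OF _ assms(1)] by (intro card_mono) auto
  also have "\<dots> \<le> (\<Sum>S\<in>?I. card (Pow (Pow S)))"
    using fin by (intro card_UN_le) auto
  also have "\<dots> = (\<Sum>S\<in>?I. 2 ^ 2 ^ s)"
  proof (intro sum.cong refl)
    fix S assume "S \<in> ?I"
    then have "finite S" "card S = s" using assms(1) finite_subset by auto
    then show "card (Pow (Pow S)) = 2 ^ 2 ^ s" by (simp add: card_Pow)
  qed
  also have "\<dots> = card ?I * 2 ^ 2 ^ s" by simp
  also have "\<dots> \<le> card X ^ (s - 1) * 2 ^ 2 ^ s"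
  proof (intro mult_right_mono)
    have "card ?I \<le> card (insert v ` {S. S \<subseteq> X \<and> card S = s - 1})"
      using fin by (intro card_mono) auto
    also have "\<dots> \<le> card {S. S \<subseteq> X \<and> card S = s - 1}"
      by (rule card_image_le[OF fin])
    also have "\<dots> = card X choose (s - 1)"
      by (rule n_subsets[OF assms(1)])
    also have "\<dots> \<le> (card X choose (s - 1)) * fact (s - 1)"
      by simp
    also have "\<dots> \<le> card X ^ (s - 1)"
      by (rule binomial_fact_pow)
    finally show "card ?I \<le> card X ^ (s - 1)" .
  qed simp
  finally show ?thesis .
qed

text \<open>Two families with a common edge have a common vertex, since edges are nonempty for
  \<open>k \<ge> 1\<close>; summing over that vertex gives order n^(2s-1), one factor n below the
  order n^(2s) of all pairs.\<close>

lemma card_intersecting_pairs_le: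
  assumes "finite X" "s \<ge> 1" "k \<ge> 1"
  shows "card {(A, B) \<in> edge_families k r s X \<times> edge_families k r s X. A \<inter> B \<noteq> {}}
    \<le> card X * (card X ^ (s - 1) * 2 ^ 2 ^ s)\<^sup>2"
proof -
  let ?F = "edge_families k r s X"
  let ?V = "\<lambda>v. {A \<in> ?F. v \<in> \<Union>A}"
  have fin: "finite ?F"
    by (rule finite_edge_families[OF assms(1)])
  have "{(A, B) \<in> ?F \<times> ?F. A \<inter> B \<noteq> {}} \<subseteq> (\<Union>v\<in>X. ?V v \<times> ?V v)"
  proof clarify
    fix A B assume AB: "A \<in> ?F" "B \<in> ?F" "A \<inter> B \<noteq> {}"
    then obtain e where e: "e \<in> A" "e \<in> B" by blast
    then have "e \<subseteq> X" "card e = k" using AB by (auto simp: edge_families_def)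
    then obtain v where "v \<in> e" "v \<in> X"
      using assms(3) by (cases "e = {}") auto
    then show "(A, B) \<in> (\<Union>v\<in>X. ?V v \<times> ?V v)"
      using e AB by blast
  qed
  then have "card {(A, B) \<in> ?F \<times> ?F. A \<inter> B \<noteq> {}} \<le> card (\<Union>v\<in>X. ?V v \<times> ?V v)"
    using fin assms(1) by (intro card_mono) auto
  also have "\<dots> \<le> (\<Sum>v\<in>X. card (?V v \<times> ?V v))"
    by (intro card_UN_le assms(1))
  also have "\<dots> \<le> (\<Sum>v\<in>X. (card X ^ (s - 1) * 2 ^ 2 ^ s)\<^sup>2)"
    unfolding card_cartesian_product power2_eq_square
    by (intro sum_mono mult_mono card_edge_families_at_vertex_le assms(1,2)) auto
  finally show ?thesis by simp
qed

section \<open>Bounds on the number of unions and on their expected weight\<close>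

lemma card_edge_unions_le_families:
  assumes "finite X" "H \<subseteq> {e. e \<subseteq> X \<and> card e = k}"
  shows "card (edge_unions r s H) \<le> card {A \<in> edge_families k r s X. A \<subseteq> H}"
proof -
  have "{A \<in> edge_families k r s X. A \<subseteq> H} = {A. A \<subseteq> H \<and> card A = r \<and> card (\<Union>A) = s}"
    using assms(2) unfolding edge_families_def by blast
  then have "edge_unions r s H = \<Union> ` {A \<in> edge_families k r s X. A \<subseteq> H}"
    by (simp only: edge_unions_def setcompr_eq_image)
  then show ?thesis
    using finite_edge_families[OF assms(1)] by (simp add: card_image_le)
qed

text \<open>The crude bound for small \<open>p\<close>, where all \<open>s\<close>-subsets together
  are light.\<close>

lemma card_edge_unions_le_vertex_sets:
  assumes "finite X" "H \<subseteq> {e. e \<subseteq> X \<and> card e = k}"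
  shows "card (edge_unions r s H) \<le> card X choose s"
proof -
  have "edge_unions r s H \<subseteq> {S. S \<subseteq> X \<and> card S = s}"
    using assms(2) by (auto simp: edge_unions_def)
  then have "card (edge_unions r s H) \<le> card {S. S \<subseteq> X \<and> card S = s}"
    by (intro card_mono finite_subsets_of_size assms(1))
  then show ?thesis by (simp add: n_subsets[OF assms(1)])
qed

text \<open>Each union comes from a choice of \<open>r\<close> edges; this handles the largest size
  \<open>s = k * r\<close>.\<close>

lemma card_edge_unions_le_edge_sets:
  assumes "finite H"
  shows "card (edge_unions r s H) \<le> card H choose r"
proof -
  have "edge_unions r s H \<subseteq> \<Union> ` {A. A \<subseteq> H \<and> card A = r}"
    by (auto simp: edge_unions_def)
  then have "card (edge_unions r s H) \<le> card {A. A \<subseteq> H \<and> card A = r}"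
    using finite_subsets_of_size[OF assms] by (rule surj_card_le[rotated])
  then show ?thesis by (simp add: n_subsets[OF assms])
qed

text \<open>With t = np/s the weight splits into a vertex part, the choice of the union together
  with (p/L)^s, and an edge part, the choice of \<open>r\<close> edges inside it together with their
  probability. The normalisation \<open>real m * p ^ k = real r\<close> removes \<open>m\<close>
  from the edge part.\<close>

lemma expected_weight_bound:
  assumes "finite X" "card X = n" "m \<le> n choose k" "k \<le> n" "s \<le> n" "s \<ge> 1" "r \<ge> 1"
    and p: "p > 0" "real m * p ^ k = real r" and "L > 0"
  shows "real (card (edge_families k r s X)) * binomial_ratio m (n choose k) r * (p / L) ^ s
    \<le> (exp 1 * (real n * p / real s) / L) ^ s * (exp 1 / (real n * p / real s) ^ k) ^ r"
proof -
  let ?M = "s choose k" and ?N = "n choose k"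
  have m0: "m > 0" using p \<open>r \<ge> 1\<close> by (cases m) auto
  have n0: "n > 0" using assms by simp
  have N0: "?N > 0" using \<open>k \<le> n\<close> by simp
  \<comment> \<open>The quotient is itself \<open>binomial_ratio s n k\<close>, so the power bound
    applies with \<open>s\<close> and \<open>n\<close> in place of \<open>m\<close> and
    \<open>N\<close>.\<close>
  have ratio: "real ?M / real ?N \<le> (real s / real n) ^ k"
    using binomial_ratio_le_power[OF \<open>s \<le> n\<close>, of k] by (simp add: binomial_ratio_def)
  have mr: "real m / real r = 1 / p ^ k"
    using p \<open>r \<ge> 1\<close> by (simp add: field_simps)
  have "real (?M choose r) * (real m / real ?N) ^ r
      \<le> (exp 1 * real ?M / real r) ^ r * (real m / real ?N) ^ r"
    by (intro mult_right_mono binomial_le_exp_power) auto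
  also have "\<dots> = (exp 1 * (real ?M / real ?N) * (real m / real r)) ^ r"
    by (simp add: mult_ac flip: power_mult_distrib)
  also have "\<dots> \<le> (exp 1 * (real s / real n) ^ k * (1 / p ^ k)) ^ r"
    unfolding mr using p ratio by (intro power_mono mult_right_mono mult_left_mono) auto
  also have "\<dots> = (exp 1 / (real n * p / real s) ^ k) ^ r"
    by (simp add: power_divide power_mult_distrib mult_ac)
  finally have edges: "real (?M choose r) * (real m / real ?N) ^ r
    \<le> (exp 1 / (real n * p / real s) ^ k) ^ r" .
  have "real (n choose s) * (p / L) ^ s \<le> (exp 1 * real n / real s) ^ s * (p / L) ^ s"
    using p \<open>L > 0\<close> by (intro mult_right_mono binomial_le_exp_power) auto
  also have "\<dots> = (exp 1 * (real n * p / real s) / L) ^ s"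
    by (simp add: mult_ac flip: power_mult_distrib)
  finally have vertices: "real (n choose s) * (p / L) ^ s
    \<le> (exp 1 * (real n * p / real s) / L) ^ s" .
  have "real (card (edge_families k r s X)) * binomial_ratio m ?N r * (p / L) ^ s
      \<le> (real (n choose s) * real (?M choose r)) * (real m / real ?N) ^ r * (p / L) ^ s"
    using card_edge_families_le[OF assms(1), of k r s] assms(2) p \<open>L > 0\<close>
    by (intro mult_mono binomial_ratio_le_power assms(3))
      (auto simp: binomial_ratio_nonneg simp flip: of_nat_mult)
  also have "\<dots> = (real (n choose s) * (p / L) ^ s) * (real (?M choose r) * (real m / real ?N) ^ r)"
    by (simp add: mult_ac)
  also have "\<dots> \<le> (exp 1 * (real n * p / real s) / L) ^ s * (exp 1 / (real n * p / real s) ^ k) ^ r"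
    using p \<open>L > 0\<close> by (intro mult_mono edges vertices) auto
  finally show ?thesis .
qed

text \<open>Collecting powers of \<open>t\<close> leaves the nonnegative exponent
  \<open>k * r - s\<close> in a denominator; both regimes are read off from this form.\<close>

lemma expected_weight_bound_eq:
  fixes t L :: real
  assumes "s \<le> k * r" "t > 0"
  shows "(exp 1 * t / L) ^ s * (exp 1 / t ^ k) ^ r = (exp 1 / L) ^ s * (exp (real r) / t ^ (k * r - s))"
proof -
  have "(exp 1 / t ^ k) ^ r = exp (real r) / t ^ (k * r)"
    using exp_of_nat_mult[of r "1::real"] by (simp only: power_divide power_mult mult_1_right)
  also have "t ^ (k * r) = t ^ s * t ^ (k * r - s)"
    using assms by (simp only: flip: power_add) simp
  finally have eq: "(exp 1 / t ^ k) ^ r = exp (real r) / (t ^ s * t ^ (k * r - s))" .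
  have "(exp 1 * t / L) ^ s = (exp 1 / L) ^ s * t ^ s"
    by (simp flip: power_mult_distrib)
  with eq show ?thesis
    using assms(2) by simp
qed

text \<open>From r <= 2kr = 2(kr - s) + 2s, the factor e^r is at most t^(kr - s) times e^(2s). What
  remains is (e^3/L)^s, and the constant 4e^3 makes it at most 4^(-s).\<close>

lemma expected_weight_le_quarter:
  fixes t L :: real
  assumes "s \<le> k * r" "k \<ge> 1" "L \<ge> 4 * exp 1 ^ 3" "t \<ge> exp 1 ^ 2"
  shows "(exp 1 * t / L) ^ s * (exp 1 / t ^ k) ^ r \<le> (1 / 4) ^ s"
proof -
  have t0: "t > 0" using less_le_trans[OF _ assms(4), of 0] by simp
  have L0: "L > 0" using less_le_trans[OF _ assms(3), of 0] by simp
  have "r \<le> k * r" using assms(2) by simp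
  then have "real r \<le> real (k * r)" by (rule of_nat_mono)
  then have "exp (real r) \<le> exp (real (2 * (k * r)))"
    by (subst exp_le_cancel_iff) linarith
  also have "\<dots> = (exp 1 ^ 2) ^ (k * r - s) * (exp 1 ^ 2) ^ s"
    using assms(1) exp_of_nat_mult[of "2 * (k * r)" "1::real"]
    by (simp flip: power_add power_mult)
  also have "\<dots> \<le> t ^ (k * r - s) * (exp 1 ^ 2) ^ s"
    using assms(4) by (intro mult_right_mono power_mono) auto
  finally have "exp (real r) / t ^ (k * r - s) \<le> (exp 1 ^ 2) ^ s"
    using t0 by (simp add: field_simps)
  then have "(exp 1 / L) ^ s * (exp (real r) / t ^ (k * r - s)) \<le> (exp 1 / L) ^ s * (exp 1 ^ 2) ^ s"
    using L0 by (intro mult_left_mono) auto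
  also have "\<dots> = (exp 1 ^ 3 / L) ^ s"
    by (simp add: power2_eq_square power3_eq_cube mult_ac flip: power_mult_distrib)
  also have "\<dots> \<le> (1 / 4) ^ s"
    using assms(3) L0 by (intro power_mono) (auto simp: field_simps)
  finally show ?thesis
    using expected_weight_bound_eq[OF assms(1) t0] by simp
qed

text \<open>Since \<open>s < k * r\<close>, at least one factor \<open>t\<close> survives in the
  denominator.\<close>

lemma expected_weight_le_sparse:
  fixes t L :: real
  assumes "s < k * r" "L \<ge> exp 1" "t \<ge> 1"
  shows "(exp 1 * t / L) ^ s * (exp 1 / t ^ k) ^ r \<le> exp (real r) / t"
proof -
  have L0: "L > 0" using less_le_trans[OF _ assms(2), of 0] by simp
  have "t \<le> t ^ (k * r - s)"
    using assms by (intro self_le_power) auto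
  then have "(exp 1 / L) ^ s * (exp (real r) / t ^ (k * r - s)) \<le> 1 * (exp (real r) / t)"
    using assms L0 by (intro mult_mono power_le_one divide_left_mono) (auto simp: field_simps)
  then show ?thesis
    using expected_weight_bound_eq[of s k r t L] assms by simp
qed

subsection \<open>The weight of the layers\<close>

text \<open>The cut-off \<open>T\<close> is a free parameter: the first summand is the Markov error
  for \<open>t \<ge> T\<close>, the second the Chebyshev error for \<open>t < T\<close>. Both are
  nonnegative, so their sum serves in every case.\<close>

lemma prob_heavy_layer:
  fixes T :: real
  assumes X: "finite X" "card X = n" and "m \<le> n choose k" "k \<le> n" "s \<le> n"
    and "k \<ge> 1" "r \<ge> 1" "s \<ge> 1" "s < k * r"
    and p: "p > 0" "real m * p ^ k = real r" and L: "L \<ge> 4 * exp 1 ^ 3" and "T \<ge> 1"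
  shows "measure_pmf.prob (random_hypergraph k X m)
      {H. (1 / 2) ^ s < real (card (edge_unions r s H)) * (p / L) ^ s}
    \<le> 2 ^ s * exp (real r) / T + 4 ^ (s + 1) * (2 ^ 2 ^ s)\<^sup>2 * (real s * T) ^ (2 * s) / real n"
    (is "measure_pmf.prob ?M ?B \<le> ?b1 + ?b2")
proof -
  define E where "E = {e. e \<subseteq> X \<and> card e = k}"
  define F where "F = edge_families k r s X"
  define t where "t = real n * p / real s"
  define c where "c = (p / L) ^ s"
  have E: "finite E" "card E = n choose k"
    using X by (auto simp: E_def n_subsets finite_subsets_of_size)
  have F: "A \<subseteq> E \<and> card A = r" if "A \<in> F" for A
    using that by (auto simp: F_def E_def edge_families_def)
  have M: "?M = pmf_of_set {H. H \<subseteq> E \<and> card H = m}"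
    by (simp add: random_hypergraph_def E_def)
  have set_M: "H \<subseteq> E" if "H \<in> set_pmf ?M" for H
    using that E \<open>m \<le> n choose k\<close>
    by (simp add: M set_pmf_of_set[OF subsets_of_size_nonempty finite_subsets_of_size])
  have n0: "n > 0" using assms by simp
  have "exp 1 \<le> (exp 1 :: real) ^ 3" by (rule self_le_power) auto
  then have L_e: "L \<ge> exp 1" and L0: "L > 0" and L1: "L \<ge> 1"
    using L exp_ge_add_one_self[of "1::real"] by auto
  have t0: "t > 0" using n0 p assms by (simp add: t_def)
  have c0: "c > 0" using p L0 by (simp add: c_def)
  have b1: "?b1 \<ge> 0" and b2: "?b2 \<ge> 0" using \<open>T \<ge> 1\<close> by simp_all
  have mean: "real (card F) * binomial_ratio m (card E) r * c
      \<le> (exp 1 * t / L) ^ s * (exp 1 / t ^ k) ^ r"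
    using expected_weight_bound[of X n m k s r p L] assms L0
    by (simp only: F_def E c_def t_def)
  have prob_mono: "measure_pmf.prob ?M ?B \<le> measure_pmf.prob ?M C"
    if "\<And>H. H \<subseteq> E \<Longrightarrow> (1 / 2) ^ s < real (card (edge_unions r s H)) * c \<Longrightarrow> H \<in> C" for C
  proof -
    have "measure_pmf.prob ?M ?B = measure_pmf.prob ?M (?B \<inter> set_pmf ?M)"
      by (simp add: measure_Int_set_pmf)
    also have "\<dots> \<le> measure_pmf.prob ?M C"
      using that set_M by (intro measure_pmf.finite_measure_mono) (auto simp: c_def)
    finally show ?thesis .
  qed
  have unions_le: "real (card (edge_unions r s H)) * c \<le> real (card {A \<in> F. A \<subseteq> H}) * c"
    if "H \<subseteq> E" for H
    using card_edge_unions_le_families[OF X(1), of H k r s] that c0 by (simp add: F_def E_def)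
  consider "t \<le> exp 1 ^ 2" | "t > exp 1 ^ 2" "t \<ge> T" | "t > exp 1 ^ 2" "t < T" by linarith
  then show ?thesis
  proof cases
    case 1
    \<comment> \<open>All \<open>s\<close>-subsets together weigh at most (e^3/L)^s here, so no
      sample in the support is heavy.\<close>
    have "(1 / 2) ^ s \<ge> real (card (edge_unions r s H)) * c" if "H \<subseteq> E" for H
    proof -
      have "real (card (edge_unions r s H)) * c \<le> real (n choose s) * c"
        using card_edge_unions_le_vertex_sets[OF X(1), of H k r s] that c0 X by (simp add: E_def)
      also have "\<dots> \<le> (exp 1 * real n / real s) ^ s * c"
        using c0 by (intro mult_right_mono binomial_le_exp_power) auto
      also have "\<dots> = (exp 1 * t / L) ^ s"
        by (simp add: c_def t_def mult_ac flip: power_mult_distrib)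
      also have "\<dots> \<le> (exp 1 * exp 1 ^ 2 / L) ^ s"
        using 1 t0 L0 by (intro power_mono divide_right_mono mult_left_mono) auto
      also have "\<dots> \<le> (1 / 2) ^ s"
      proof (rule power_mono)
        have "exp 1 * exp 1 ^ 2 = (exp 1 :: real) ^ 3"
          by (simp add: power2_eq_square power3_eq_cube)
        also have "\<dots> \<le> 1 / 2 * L"
          using L zero_le_power[OF exp_ge_zero, of "1 :: real" 3] by linarith
        finally have "exp 1 * exp 1 ^ 2 \<le> 1 / 2 * L" .
        then show "exp 1 * exp 1 ^ 2 / L \<le> 1 / 2"
          using L0 by (simp add: divide_le_eq)
      qed (use L0 in simp)
      finally show ?thesis .
    qed
    then have "measure_pmf.prob ?M ?B \<le> measure_pmf.prob ?M {}"
      by (intro prob_mono) (auto simp: not_less[symmetric])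
    then have "measure_pmf.prob ?M ?B \<le> 0" by simp
    with b1 b2 show ?thesis by linarith
  next
    case 2
    have t1: "t \<ge> 1" using 2 \<open>T \<ge> 1\<close> by simp
    \<comment> \<open>The number of unions of size \<open>s\<close> at which the weight reaches
      (1/2)^s.\<close>
    define a where "a = (1 / 2) ^ s / c"
    have a0: "a > 0" using c0 by (simp add: a_def)
    have "measure_pmf.prob ?M ?B \<le> measure_pmf.prob ?M {H. a \<le> real (card {A \<in> F. A \<subseteq> H})}"
    proof (intro prob_mono CollectI)
      fix H assume "H \<subseteq> E" "(1 / 2) ^ s < real (card (edge_unions r s H)) * c"
      then have "(1 / 2) ^ s \<le> real (card {A \<in> F. A \<subseteq> H}) * c"
        using unions_le[of H] by linarith
      then show "a \<le> real (card {A \<in> F. A \<subseteq> H})"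
        using c0 by (simp add: a_def divide_le_eq)
    qed
    also have "\<dots> \<le> real (card F) * binomial_ratio m (card E) r / a"
      unfolding M
      using prob_contained_Markov[of E m F r a] E F \<open>m \<le> n choose k\<close> a0 by simp
    also have "\<dots> = 2 ^ s * (real (card F) * binomial_ratio m (card E) r * c)"
      by (simp add: a_def power_one_over)
    also have "\<dots> \<le> 2 ^ s * (exp (real r) / t)"
      using mean expected_weight_le_sparse[OF \<open>s < k * r\<close> L_e t1] by (intro mult_left_mono) auto
    also have "\<dots> \<le> 2 ^ s * (exp (real r) / T)"
      using 2 \<open>T \<ge> 1\<close> by (intro mult_left_mono divide_left_mono) auto
    finally show ?thesis using b2 unfolding times_divide_eq_right by linarith
  next
    case 3
    define D where "D = {(A, B) \<in> F \<times> F. A \<inter> B \<noteq> {}}"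
    \<comment> \<open>The allowance (1/2)^s is halved: the mean takes at most 4^(-s) <= (1/2)^(s+1),
      as \<open>s \<ge> 1\<close>, and a deviation by \<open>a\<close> takes the other half.\<close>
    define a where "a = (1 / 2) ^ (s + 1) / c"
    let ?\<mu> = "real (card F) * binomial_ratio m (card E) r"
    have a0: "a > 0" using c0 by (simp add: a_def)
    have ac: "a * c = (1 / 2) ^ (s + 1)" using c0 by (simp add: a_def)
    have "?\<mu> * c \<le> (1 / 4) ^ s"
      using mean expected_weight_le_quarter[of s k r L t] assms 3 by linarith
    also have "(1 / 4 :: real) ^ s = (1 / 2) ^ s * (1 / 2) ^ s"
      by (simp flip: power_mult_distrib)
    also have "\<dots> \<le> (1 / 2) ^ s * (1 / 2) ^ 1"
      using \<open>s \<ge> 1\<close> by (intro mult_left_mono power_decreasing) auto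
    finally have "(?\<mu> + a) * c \<le> (1 / 2) ^ s"
      using ac by (simp add: distrib_right)
    then have "measure_pmf.prob ?M ?B
        \<le> measure_pmf.prob ?M {H. ?\<mu> + a \<le> real (card {A \<in> F. A \<subseteq> H})}"
    proof (intro prob_mono, clarify)
      fix H assume H: "(?\<mu> + a) * c \<le> (1 / 2) ^ s" "H \<subseteq> E"
        "(1 / 2) ^ s < real (card (edge_unions r s H)) * c"
      then have "(?\<mu> + a) * c \<le> real (card {A \<in> F. A \<subseteq> H}) * c"
        using unions_le[of H] by linarith
      then show "?\<mu> + a \<le> real (card {A \<in> F. A \<subseteq> H})"
        using c0 by simp
    qed
    also have "\<dots> \<le> real (card D) / a\<^sup>2"
      unfolding M D_def
      using prob_contained_Chebyshev[of E m F r a] E F \<open>m \<le> n choose k\<close> a0 by simp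
    also have "\<dots> = 4 ^ (s + 1) * (real (card D) * c\<^sup>2)"
    proof -
      have "((1 / 2) ^ (s + 1))\<^sup>2 = (1 / 4 :: real) ^ (s + 1)"
        by (simp only: power2_eq_square flip: power_mult_distrib) simp
      then have "a\<^sup>2 = 1 / 4 ^ (s + 1) / c\<^sup>2"
        by (simp only: a_def power_divide power_one)
      then show ?thesis by simp
    qed
    also have "\<dots> \<le> 4 ^ (s + 1) * ((2 ^ 2 ^ s)\<^sup>2 * (real s * T) ^ (2 * s) / real n)"
    proof (intro mult_left_mono)
      have "card D \<le> n * (n ^ (s - 1) * 2 ^ 2 ^ s)\<^sup>2"
        using card_intersecting_pairs_le[OF X(1) \<open>s \<ge> 1\<close> \<open>k \<ge> 1\<close>, of r] X
        by (simp add: D_def F_def)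
      then have D: "real (card D) \<le> real n * (real n ^ (s - 1) * 2 ^ 2 ^ s)\<^sup>2"
        by (simp only: flip: of_nat_le_iff[where 'a = real]) simp
      \<comment> \<open>Here \<open>t < T\<close> bounds \<open>p\<close> by sT/n, so
        \<open>c\<^sup>2\<close> supplies n^(-2s) against the n^(2s-1) intersecting pairs; a factor
        1/n is left.\<close>
      have "p / L \<le> p / 1" using p L0 L1 by (intro divide_left_mono) auto
      also have "p \<le> real s * T / real n"
        using 3 n0 \<open>s \<ge> 1\<close> by (simp add: t_def field_simps)
      finally have "c \<le> (real s * T / real n) ^ s"
        using p L0 unfolding c_def by (intro power_mono) auto
      then have "real (card D) * c\<^sup>2
          \<le> real n * (real n ^ (s - 1) * 2 ^ 2 ^ s)\<^sup>2 * ((real s * T / real n) ^ s)\<^sup>2"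
        using D c0 by (intro mult_mono power_mono) auto
      also have "\<dots> = (2 ^ 2 ^ s)\<^sup>2 * (real s * T) ^ (2 * s) / real n"
      proof -
        have "real n ^ s = real n * real n ^ (s - 1)"
          using \<open>s \<ge> 1\<close> by (metis One_nat_def Suc_le_D diff_Suc_1 power_Suc)
        then have "real n * (real n ^ (s - 1) * 2 ^ 2 ^ s)\<^sup>2
            = (real n ^ s * 2 ^ 2 ^ s)\<^sup>2 / real n"
          using n0 by (simp add: power2_eq_square)
        then show ?thesis
          using n0 by (simp add: power_divide power_mult_distrib power_mult[symmetric] mult.commute)
      qed
      finally show "real (card D) * c\<^sup>2 \<le> (2 ^ 2 ^ s)\<^sup>2 * (real s * T) ^ (2 * s) / real n" .
    qed simp
    finally show ?thesis using b1 by (simp add: mult_ac)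
  qed
qed

text \<open>No randomness enters: (m choose r) (p/L)^(kr) is at most (e m p^k / (r L^k))^r =
  (e/L^k)^r, and e <= L/2 <= (L/2)^k.\<close>

lemma top_layer_light:
  assumes "finite H" "card H = m" "k \<ge> 1" "r \<ge> 1"
    and p: "p > 0" "real m * p ^ k = real r" and L: "L \<ge> 4 * exp 1 ^ 3"
  shows "real (card (edge_unions r (k * r) H)) * (p / L) ^ (k * r) \<le> (1 / 2) ^ (k * r)"
proof -
  have "exp 1 \<le> (exp 1 :: real) ^ 3" by (rule self_le_power) auto
  then have L2: "L / 2 \<ge> exp 1" and L0: "L > 0" and "L / 2 \<ge> 1"
    using L exp_ge_add_one_self[of "1::real"] by auto
  then have "exp 1 \<le> (L / 2) ^ k"
    using self_le_power[of "L / 2" k] \<open>k \<ge> 1\<close> by linarith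
  then have ek: "exp 1 / L ^ k \<le> (1 / 2) ^ k"
    using L0 by (simp add: power_divide field_simps)
  have "real (card (edge_unions r (k * r) H)) * (p / L) ^ (k * r)
      \<le> real (m choose r) * (p / L) ^ (k * r)"
    using card_edge_unions_le_edge_sets[OF assms(1), of r "k * r"] assms(2) p L0
    by (intro mult_right_mono) auto
  also have "\<dots> \<le> (exp 1 * real m / real r) ^ r * (p / L) ^ (k * r)"
    using p L0 by (intro mult_right_mono binomial_le_exp_power) auto
  also have "\<dots> = (exp 1 * (real m * p ^ k) / (real r * L ^ k)) ^ r"
    by (simp add: power_mult power_divide mult_ac flip: power_mult_distrib)
  also have "\<dots> = (exp 1 / L ^ k) ^ r"
    using p \<open>r \<ge> 1\<close> by simp
  also have "\<dots> \<le> ((1 / 2) ^ k) ^ r"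
    using ek L0 by (intro power_mono) auto
  finally show ?thesis by (simp add: power_mult)
qed

section \<open>The cover by unions of \<open>r\<close> edges\<close>

lemma frac_weight_scaled_indicator:
  assumes "finite X" "H \<subseteq> {e. e \<subseteq> X \<and> card e = k}" "r \<ge> 1"
  shows "frac_weight X (scaled_indicator r H) p = real (card H) * p ^ k / real r"
proof -
  have "frac_weight X (scaled_indicator r H) p = (\<Sum>S\<in>Pow X. indicator H S * (p ^ k / real r))"
    unfolding frac_weight_def scaled_indicator_def
    using assms(2) by (intro sum.cong) (auto simp: indicator_def)
  also have "\<dots> = (\<Sum>S\<in>Pow X. indicator H S) * (p ^ k / real r)"
    by (rule sum_distrib_right[symmetric])
  also have "(\<Sum>S\<in>Pow X. indicator H S) = real (card (Pow X \<inter> H))"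
    using assms(1) by (simp add: indicator_def sum_of_bool_eq)
  also have "Pow X \<inter> H = H" using assms(2) by auto
  finally show ?thesis by simp
qed

text \<open>Each edge inside \<open>S\<close> contributes 1/r, so a total of at least 1 means at
  least \<open>r\<close> edges; the union of any \<open>r\<close> of them lies in
  \<open>S\<close>.\<close>

lemma frac_upset_subset_unions:
  assumes "finite X" "H \<subseteq> {e. e \<subseteq> X \<and> card e = k}" "r \<ge> 1"
  shows "frac_upset X (scaled_indicator r H) \<subseteq> upset X {\<Union>A | A. A \<subseteq> H \<and> card A = r}"
proof
  fix S assume "S \<in> frac_upset X (scaled_indicator r H)"
  then have S: "S \<subseteq> X" "(\<Sum>T\<in>Pow S. scaled_indicator r H T) \<ge> 1"
    by (auto simp: frac_upset_def)
  have "finite S" using S(1) assms(1) by (rule finite_subset)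
  then have "(\<Sum>T\<in>Pow S. scaled_indicator r H T) = real (card (Pow S \<inter> H)) / real r"
    by (simp add: scaled_indicator_def indicator_def sum_of_bool_eq flip: sum_divide_distrib)
  with S(2) assms(3) have "r \<le> card (Pow S \<inter> H)" by (simp add: field_simps)
  then obtain A where "A \<subseteq> Pow S \<inter> H" "card A = r"
    by (rule obtain_subset_with_card_n)
  then have "\<Union>A \<subseteq> S" "A \<subseteq> H" by auto
  with S(1) \<open>card A = r\<close> show "S \<in> upset X {\<Union>A | A. A \<subseteq> H \<and> card A = r}"
    unfolding upset_def by blast
qed

text \<open>There is an edge because \<open>r \<ge> 1\<close>, and it has a vertex because
  \<open>k \<ge> 1\<close>; this keeps the empty set out of the cover.\<close>

lemma edge_cover_layers:
  assumes "finite X" "H \<subseteq> {e. e \<subseteq> X \<and> card e = k}" "k \<ge> 1" "r \<ge> 1"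
    and "S \<in> {\<Union>A | A. A \<subseteq> H \<and> card A = r}"
  shows "S \<subseteq> X" "card S \<in> {1..k * r}"
proof -
  obtain A where A: "S = \<Union>A" "A \<subseteq> H" "card A = r" using assms(5) by blast
  then have "A \<noteq> {}" using \<open>r \<ge> 1\<close> by (cases "A = {}") auto
  then obtain e where e: "e \<in> A" by blast
  show "S \<subseteq> X" using A assms(2) by blast
  then have "finite S" using assms(1) by (rule finite_subset)
  moreover have "e \<subseteq> S" using e A(1) by blast
  ultimately have "card e \<le> card S" by (rule card_mono)
  moreover have "card e = k" using e A(2) assms(2) by blast
  moreover have "card S \<le> (\<Sum>e\<in>A. card e)" unfolding A by (rule card_Union_le_sum_card)
  moreover have "(\<Sum>e\<in>A. card e) = (\<Sum>e\<in>A. k)"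
    using A(2) assms(2) by (intro sum.cong refl) blast
  ultimately show "card S \<in> {1..k * r}"
    using A(3) \<open>k \<ge> 1\<close> by (simp add: mult.commute)
qed

lemma weight_layers:
  assumes "finite G" "card ` G \<subseteq> {1..N}"
  shows "weight G x = (\<Sum>s\<in>{1..N}. real (card {S \<in> G. card S = s}) * x ^ s)"
proof -
  have "weight G x = (\<Sum>s\<in>{1..N}. \<Sum>S\<in>{S \<in> G. card S = s}. x ^ card S)"
    unfolding weight_def
    using sum.group[OF assms(1) _ assms(2), of "\<lambda>S. x ^ card S"] by simp
  also have "\<dots> = (\<Sum>s\<in>{1..N}. \<Sum>S\<in>{S \<in> G. card S = s}. x ^ s)"
    by (intro sum.cong refl) simp
  finally show ?thesis by simp
qed

text \<open>The layer budgets (1/2)^s for s >= 1 form a geometric series with sum below 1. The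
  argument \<open>x\<close> stands for p/L.\<close>

lemma exists_light_cover:
  assumes "finite X" "H \<subseteq> {e. e \<subseteq> X \<and> card e = k}" "k \<ge> 1" "r \<ge> 1"
    and light: "\<And>s. s \<in> {1..k * r} \<Longrightarrow> real (card (edge_unions r s H)) * x ^ s \<le> (1 / 2) ^ s"
  shows "\<exists>G. G \<subseteq> Pow X - {{}} \<and> frac_upset X (scaled_indicator r H) \<subseteq> upset X G \<and> weight G x \<le> 1"
proof -
  define G where "G = {\<Union>A | A. A \<subseteq> H \<and> card A = r}"
  have layers: "S \<subseteq> X" "card S \<in> {1..k * r}" if "S \<in> G" for S
    using edge_cover_layers[OF assms(1-4)] that unfolding G_def by blast+
  have G: "G \<subseteq> Pow X - {{}}"
  proof
    fix S assume "S \<in> G"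
    with layers(2)[OF this] layers(1)[OF this] show "S \<in> Pow X - {{}}" by auto
  qed
  then have "G \<subseteq> Pow X" by blast
  then have "finite G" by (rule finite_subset) (simp add: assms(1))
  moreover have "card ` G \<subseteq> {1..k * r}" using layers(2) by blast
  ultimately have "weight G x = (\<Sum>s\<in>{1..k * r}. real (card {S \<in> G. card S = s}) * x ^ s)"
    by (rule weight_layers)
  also have "\<dots> \<le> (\<Sum>s\<in>{1..k * r}. (1 / 2) ^ s)"
  proof (rule sum_mono)
    fix s assume s: "s \<in> {1..k * r}"
    have "{S \<in> G. card S = s} = edge_unions r s H"
      unfolding G_def edge_unions_def by blast
    with light[OF s] show "real (card {S \<in> G. card S = s}) * x ^ s \<le> (1 / 2) ^ s" by simp
  qed
  also have "(\<Sum>s\<in>{1..N}. (1 / 2) ^ s) = 1 - (1 / 2 :: real) ^ N" for N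
    by (induction N) auto
  also have "1 - (1 / 2 :: real) ^ (k * r) \<le> 1" by simp
  finally have "weight G x \<le> 1" .
  moreover have "frac_upset X (scaled_indicator r H) \<subseteq> upset X G"
    unfolding G_def by (rule frac_upset_subset_unions[OF assms(1,2,4)])
  ultimately show ?thesis using G by (intro exI[of _ G] conjI)
qed

text \<open>A union bound over the sizes below \<open>k * r\<close>; the size \<open>k * r\<close>
  itself is light for every sample in the support.\<close>

lemma prob_light_cover_ge:
  fixes T :: real
  assumes X: "finite X" "card X = n" and "m \<le> n choose k" "k * r \<le> n" "k \<ge> 1" "r \<ge> 1"
    and L: "L \<ge> 4 * exp 1 ^ 3" and "T \<ge> 1"
  shows "measure_pmf.prob (random_hypergraph k X m)
      {H. \<forall>p::real. 0 \<le> p \<and> p \<le> 1 \<and> frac_weight X (scaled_indicator r H) p = 1 \<longrightarrow>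
        (\<exists>G. G \<subseteq> Pow X - {{}} \<and> frac_upset X (scaled_indicator r H) \<subseteq> upset X G \<and>
          weight G (p / L) \<le> 1)}
    \<ge> 1 - (\<Sum>s\<in>{1..<k * r}. 2 ^ s * exp (real r) / T
        + 4 ^ (s + 1) * (2 ^ 2 ^ s)\<^sup>2 * (real s * T) ^ (2 * s) / real n)"
    (is "measure_pmf.prob ?M ?Good \<ge> 1 - (\<Sum>s\<in>_. ?b s)")
proof -
  \<comment> \<open>The only candidate for \<open>p\<close>, fixed before sampling, so that the bad
    events refer to a single value although the claim quantifies over \<open>p\<close> after the
    sample is drawn.\<close>
  define p\<^sub>0 where "p\<^sub>0 = root k (real r / real m)"
  define Bad where "Bad s = {H :: 'a set set.
    (1 / 2) ^ s < real (card (edge_unions r s H)) * (p\<^sub>0 / L) ^ s}" for s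
  define Good where "Good = ?Good"
  have supp: "H \<subseteq> {e. e \<subseteq> X \<and> card e = k}" "finite H" "card H = m" if "H \<in> set_pmf ?M" for H
  proof -
    have E: "finite {e. e \<subseteq> X \<and> card e = k}" "m \<le> card {e. e \<subseteq> X \<and> card e = k}"
      using assms by (simp_all add: finite_subsets_of_size n_subsets)
    from that show H: "H \<subseteq> {e. e \<subseteq> X \<and> card e = k}" "card H = m"
      unfolding random_hypergraph_def
        set_pmf_of_set[OF subsets_of_size_nonempty[OF E] finite_subsets_of_size[OF E(1)]]
      by auto
    show "finite H" using H(1) E(1) by (rule finite_subset)
  qed
  have kr: "k \<le> k * r" using \<open>r \<ge> 1\<close> by simp
  then have "n \<ge> k" "n > 0" using assms by linarith+
  have p_eq: "p = p\<^sub>0" "r \<le> m" "p\<^sub>0 > 0" "real m * p\<^sub>0 ^ k = real r"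
    if "H \<in> set_pmf ?M" "0 \<le> p" "p \<le> 1" "frac_weight X (scaled_indicator r H) p = 1" for H p
  proof -
    have mp: "real m * p ^ k = real r"
      using that frac_weight_scaled_indicator[OF X(1) supp(1)[OF that(1)] \<open>r \<ge> 1\<close>] \<open>r \<ge> 1\<close>
        supp(3)[OF that(1)] by (simp add: divide_eq_eq)
    have "p ^ k \<le> 1" using that by (intro power_le_one) auto
    then have "real r \<le> real m * 1" unfolding mp[symmetric] by (intro mult_left_mono) auto
    then show "r \<le> m" by simp
    with \<open>r \<ge> 1\<close> have "m > 0" by simp
    with mp have "p ^ k = real r / real m" by (simp add: field_simps)
    then show "p = p\<^sub>0" using that(2) \<open>k \<ge> 1\<close> by (simp add: p\<^sub>0_def real_root_power_cancel
      flip: \<open>p ^ k = real r / real m\<close>)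
    then show "real m * p\<^sub>0 ^ k = real r" using mp by simp
    then have "p\<^sub>0 \<noteq> 0" using \<open>k \<ge> 1\<close> \<open>r \<ge> 1\<close> by (auto simp: power_0_left)
    then show "p\<^sub>0 > 0" using that(2) \<open>p = p\<^sub>0\<close> by simp
  qed
  have good: "H \<in> Good" if H: "H \<in> set_pmf ?M" "\<And>s. s \<in> {1..<k * r} \<Longrightarrow> H \<notin> Bad s" for H
    unfolding Good_def
  proof (intro CollectI allI impI)
    fix p :: real
    assume "0 \<le> p \<and> p \<le> 1 \<and> frac_weight X (scaled_indicator r H) p = 1"
    then have p: "p = p\<^sub>0" "p\<^sub>0 > 0" "real m * p\<^sub>0 ^ k = real r"
      using p_eq[OF H(1), of p] by auto
    show "\<exists>G. G \<subseteq> Pow X - {{}} \<and> frac_upset X (scaled_indicator r H) \<subseteq> upset X G \<and>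
          weight G (p / L) \<le> 1"
      unfolding p(1)
    proof (rule exists_light_cover[OF X(1) supp(1)[OF H(1)] \<open>k \<ge> 1\<close> \<open>r \<ge> 1\<close>])
      fix s assume s: "s \<in> {1..k * r}"
      show "real (card (edge_unions r s H)) * (p\<^sub>0 / L) ^ s \<le> (1 / 2) ^ s"
      proof (cases "s = k * r")
        case True
        then show ?thesis
          using top_layer_light[OF supp(2,3)[OF H(1)] \<open>k \<ge> 1\<close> \<open>r \<ge> 1\<close> p(2,3) L] by simp
      next
        case False
        with s H(2)[of s] show ?thesis by (simp add: Bad_def not_less)
      qed
    qed
  qed
  have b_nonneg: "(\<Sum>s\<in>{1..<k * r}. ?b s) \<ge> 0"
    using \<open>T \<ge> 1\<close> by (intro sum_nonneg) simp
  have prob_supp: "measure_pmf.prob ?M (set_pmf ?M) = 1"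
    using measure_Int_set_pmf[of ?M UNIV] by simp
  have "1 - (\<Sum>s\<in>{1..<k * r}. ?b s) \<le> measure_pmf.prob ?M Good"
  proof (cases "r \<le> m")
    case True
    with \<open>r \<ge> 1\<close> have "m > 0" by simp
    then have p0: "p\<^sub>0 > 0" "real m * p\<^sub>0 ^ k = real r"
      using \<open>k \<ge> 1\<close> \<open>r \<ge> 1\<close> by (simp_all add: p\<^sub>0_def)
    have "1 \<le> measure_pmf.prob ?M (Good \<union> (\<Union>s\<in>{1..<k * r}. Bad s))"
      unfolding prob_supp[symmetric] using good by (intro measure_pmf.finite_measure_mono) auto
    also have "\<dots> \<le> measure_pmf.prob ?M Good + measure_pmf.prob ?M (\<Union>s\<in>{1..<k * r}. Bad s)"
      by (rule measure_Un_le) auto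
    also have "measure_pmf.prob ?M (\<Union>s\<in>{1..<k * r}. Bad s)
        \<le> (\<Sum>s\<in>{1..<k * r}. measure_pmf.prob ?M (Bad s))"
      by (rule measure_UNION_le) auto
    also have "\<dots> \<le> (\<Sum>s\<in>{1..<k * r}. ?b s)"
      unfolding Bad_def using assms p0 \<open>n \<ge> k\<close>
      by (intro sum_mono prob_heavy_layer) auto
    finally show ?thesis by simp
  next
    case False
    \<comment> \<open>For m < r the equation m p^k = r has no solution in [0,1], so every sample in
      the support is good vacuously.\<close>
    have "set_pmf ?M \<subseteq> Good"
      unfolding Good_def using p_eq(2) False by blast
    then have "1 \<le> measure_pmf.prob ?M Good"
      unfolding prob_supp[symmetric] by (intro measure_pmf.finite_measure_mono) auto
    with b_nonneg show ?thesis by linarith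
  qed
  then show ?thesis by (simp only: Good_def)
qed

section \<open>Passage to the limit with a cut-off growing with \<open>n\<close>\<close>

theorem theorem2:
  fixes k r :: nat and m :: "nat \<Rightarrow> nat" and L :: real and X :: "nat \<Rightarrow> 'a set"
  assumes "k \<ge> 1" and "r \<ge> 1"
    and "\<forall>\<^sub>F n in sequentially. m n \<le> n choose k"
    and "L \<ge> 4 * exp 1 ^ 3"
    and "\<And>n. finite (X n)" and "\<And>n. card (X n) = n"
  shows "(\<lambda>n. measure_pmf.prob (random_hypergraph k (X n) (m n))
           {H. \<forall>p::real. 0 \<le> p \<and> p \<le> 1 \<and> frac_weight (X n) (scaled_indicator r H) p = 1 \<longrightarrow>
                 (\<exists>G. G \<subseteq> Pow (X n) - {{}} \<and>
                      frac_upset (X n) (scaled_indicator r H) \<subseteq> upset (X n) G \<and>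
                      weight G (p / L) \<le> 1)})
         \<longlonglongrightarrow> 1"
proof -
  \<comment> \<open>With this exponent T^(4kr) = n. As 2s + 1 <= 4kr, it follows that T^(2s)/n <=
    1/T, so both error terms are of order n^(-a).\<close>
  define a where "a = 1 / real (4 * k * r)"
  define T where "T n = real n powr a" for n
  define c where "c s = 2 ^ s * exp (real r) + 4 ^ (s + 1) * (2 ^ 2 ^ s)\<^sup>2 * real s ^ (2 * s)" for s
  define b where "b n s = 2 ^ s * exp (real r) / T n
    + 4 ^ (s + 1) * (2 ^ 2 ^ s)\<^sup>2 * (real s * T n) ^ (2 * s) / real n" for n s
  have kr: "k * r \<ge> 1" using assms(1,2) by simp
  have a0: "a > 0" and a: "a * real (4 * k * r) = 1"
    using assms(1,2) by (simp_all add: a_def)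
  have T_ge_1: "T n \<ge> 1" if "n \<ge> 1" for n
    unfolding T_def using that a0 by (intro ge_one_powr_ge_zero) auto
  have T_power: "T n ^ (4 * k * r) = real n" if "n \<ge> 1" for n
    using that a by (simp add: T_def powr_power mult.commute)
  have b_le: "b n s \<le> c s * real n powr - a" if "n \<ge> 1" "s \<in> {1..<k * r}" for n s
  proof -
    have "2 * s + 1 \<le> 4 * k * r" using that by simp
    then have "T n ^ (2 * s) * T n \<le> T n ^ (4 * k * r)"
      using power_increasing[OF _ T_ge_1[OF that(1)], of "2 * s + 1" "4 * k * r"]
      by (simp add: mult.commute)
    then have "T n ^ (2 * s) / real n \<le> 1 / T n"
      using T_power[OF that(1)] T_ge_1[OF that(1)] that(1) by (simp add: field_simps)
    then have "4 ^ (s + 1) * (2 ^ 2 ^ s)\<^sup>2 * real s ^ (2 * s) * (T n ^ (2 * s) / real n)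
        \<le> 4 ^ (s + 1) * (2 ^ 2 ^ s)\<^sup>2 * real s ^ (2 * s) * (1 / T n)"
      by (intro mult_left_mono) auto
    then have "b n s \<le> c s * (1 / T n)"
      by (simp add: b_def c_def power_mult_distrib add_divide_distrib mult_ac)
    then show ?thesis by (simp add: T_def powr_minus_divide)
  qed
  let ?P = "\<lambda>n. measure_pmf.prob (random_hypergraph k (X n) (m n))
           {H. \<forall>p::real. 0 \<le> p \<and> p \<le> 1 \<and> frac_weight (X n) (scaled_indicator r H) p = 1 \<longrightarrow>
                 (\<exists>G. G \<subseteq> Pow (X n) - {{}} \<and>
                      frac_upset (X n) (scaled_indicator r H) \<subseteq> upset (X n) G \<and>
                      weight G (p / L) \<le> 1)}"
  \<comment> \<open>Restricting to \<open>n \<ge> k * r\<close> guarantees that \<open>k\<close> and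
    every layer size are at most \<open>n\<close>.\<close>
  have lower: "\<forall>\<^sub>F n in sequentially. 1 - (\<Sum>s\<in>{1..<k * r}. c s * real n powr - a) \<le> ?P n"
    using assms(3) eventually_ge_at_top[of "k * r"]
  proof eventually_elim
    case (elim n)
    then have n1: "n \<ge> 1" using kr by linarith
    have "1 - (\<Sum>s\<in>{1..<k * r}. b n s) \<le> ?P n"
      unfolding b_def
      by (rule prob_light_cover_ge[OF assms(5,6) elim assms(1,2,4) T_ge_1[OF n1]])
    moreover have "(\<Sum>s\<in>{1..<k * r}. b n s) \<le> (\<Sum>s\<in>{1..<k * r}. c s * real n powr - a)"
      by (intro sum_mono b_le n1)
    ultimately show ?case by linarith
  qed
  have "(\<lambda>n. real n powr - a) \<longlonglongrightarrow> 0"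
    using a0 by (intro tendsto_neg_powr filterlim_real_sequentially) auto
  then have "(\<lambda>n. 1 - (\<Sum>s\<in>{1..<k * r}. c s * real n powr - a))
      \<longlonglongrightarrow> 1 - (\<Sum>s\<in>{1..<k * r}. c s * 0)"
    by (intro tendsto_intros)
  then have limit: "(\<lambda>n. 1 - (\<Sum>s\<in>{1..<k * r}. c s * real n powr - a)) \<longlonglongrightarrow> 1"
    by simp
  have upper: "\<forall>\<^sub>F n in sequentially. ?P n \<le> 1"
    by (rule always_eventually) simp
  show ?thesis
    by (rule tendsto_sandwich[OF lower upper limit tendsto_const])
qed

end
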